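(* Let $M$ be a smooth manifold, $E$ an almost product structure on $M$, $\nabla$ a linear connection on $M$, and $\nabla^{(E)}$ the product conjugate connection of $\nabla$. Let $C^E_\nabla$ and $B^E_\nabla$ be the structural and virtual tensor fields of $(\nabla,E)$. Then $$\nabla^{(E)}=\nabla-C^E_\nabla+B^E_\nabla .$$
   Context: An almost product structure on $M$ is an endomorphism $E$ of $TM$ with $E^2=I$, the identity. For a linear connection $\nabla$, $(\nabla_XE)Y=\nabla_X(EY)-E(\nabla_XY)$, and the product conjugate connection is $\nabla^{(E)}_XY:=E(\nabla_X(EY))$. The structural tensor field of $(\nabla,E)$ is $C^E_\nabla(X,Y):=\frac12[(\nabla_{EX}E)Y+(\nabla_XE)EY]$ and the virtual tensor field is $B^E_\nabla(X,Y):=\frac12[(\nabla_{EX}E)Y-(\nabla_XE)EY]$. *)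

theory Defs
  imports "HOL-Analysis.Analysis" "HOL-Library.Function_Algebras"
begin

section \<open>Smooth functions of several real variables\<close>

text \<open>Points of $n$-space are those of \<^term>\<open>Euclidean_space n\<close>: functions \<^typ>\<open>nat \<Rightarrow> real\<close> vanishing
  at all indices \<open>\<ge> n\<close>. Dimension 0 is thereby included.\<close>

definition partial_deriv :: "nat \<Rightarrow> ((nat \<Rightarrow> real) \<Rightarrow> real) \<Rightarrow> (nat \<Rightarrow> real) \<Rightarrow> real" where
  "partial_deriv i g = (\<lambda>x. deriv (\<lambda>t. g (x(i := t))) (x i))"

text \<open>$C^\infty$ on the open set \<open>V\<close>: the iterated partial derivatives of all orders exist and are
  continuous. Since \<^const>\<open>deriv\<close> is total, existence is required separately.\<close>

definition smooth_on_Rn :: "nat \<Rightarrow> (nat \<Rightarrow> real) set \<Rightarrow> ((nat \<Rightarrow> real) \<Rightarrow> real) \<Rightarrow> bool" where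
  "smooth_on_Rn n V g \<longleftrightarrow>
     (\<forall>js. set js \<subseteq> {..<n} \<longrightarrow>
        continuous_map (subtopology (Euclidean_space n) V) euclideanreal (fold partial_deriv js g) \<and>
        (\<forall>x\<in>V. \<forall>i<n. (\<lambda>t. fold partial_deriv js g (x(i := t))) field_differentiable at (x i)))"

section \<open>Smooth manifolds\<close>

type_synonym 'a chart = "'a set \<times> ('a \<Rightarrow> nat \<Rightarrow> real)"

record 'a manifold =
  mdim :: nat
  mtop :: "'a topology"
  matlas :: "'a chart set"

abbreviation points :: "'a manifold \<Rightarrow> 'a set" where
  "points M \<equiv> topspace (mtop M)"

definition is_chart :: "'a manifold \<Rightarrow> 'a chart \<Rightarrow> bool" where
  "is_chart M = (\<lambda>(U, \<phi>). openin (mtop M) U \<and> openin (Euclidean_space (mdim M)) (\<phi> ` U) \<and>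
     homeomorphic_map (subtopology (mtop M) U)
       (subtopology (Euclidean_space (mdim M)) (\<phi> ` U)) \<phi>)"

definition compatible_charts :: "'a manifold \<Rightarrow> 'a chart \<Rightarrow> 'a chart \<Rightarrow> bool" where
  "compatible_charts M = (\<lambda>(U, \<phi>) (V, \<psi>).
     \<forall>i<mdim M. smooth_on_Rn (mdim M) (\<phi> ` (U \<inter> V)) (\<lambda>x. \<psi> (inv_into U \<phi> x) i))"

text \<open>The atlas need not be maximal; any atlas determines the smooth structure.\<close>

definition smooth_manifold :: "'a manifold \<Rightarrow> bool" where
  "smooth_manifold M \<longleftrightarrow>
     Hausdorff_space (mtop M) \<and> second_countable (mtop M) \<and>
     (\<forall>c\<in>matlas M. is_chart M c) \<and>
     (\<Union>c\<in>matlas M. fst c) = points M \<and>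
     (\<forall>c\<in>matlas M. \<forall>d\<in>matlas M. compatible_charts M c d)"

text \<open>Functions on the manifold are represented by functions on the ambient type that vanish
  outside it, so that equal functions have equal representatives.\<close>

definition smooth_functions :: "'a manifold \<Rightarrow> ('a \<Rightarrow> real) set" where
  "smooth_functions M =
     {f. (\<forall>p. p \<notin> points M \<longrightarrow> f p = 0) \<and>
         (\<forall>(U, \<phi>)\<in>matlas M. smooth_on_Rn (mdim M) (\<phi> ` U) (\<lambda>x. f (inv_into U \<phi> x)))}"

section \<open>Tangent vectors and vector fields\<close>

text \<open>A tangent vector at \<open>p\<close> is a derivation at \<open>p\<close> on the smooth functions (set to 0 on functions
  that are not smooth). Sums, products and differences of functions are pointwise.\<close>

type_synonym 'a tvec = "('a \<Rightarrow> real) \<Rightarrow> real"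

type_synonym 'a vfield = "'a \<Rightarrow> 'a tvec"

definition tangent_space :: "'a manifold \<Rightarrow> 'a \<Rightarrow> 'a tvec set" where
  "tangent_space M p =
     {v. (\<forall>f. f \<notin> smooth_functions M \<longrightarrow> v f = 0) \<and>
         (\<forall>f\<in>smooth_functions M. \<forall>g\<in>smooth_functions M. v (f + g) = v f + v g) \<and>
         (\<forall>f\<in>smooth_functions M. \<forall>c. v (\<lambda>q. c * f q) = c * v f) \<and>
         (\<forall>f\<in>smooth_functions M. \<forall>g\<in>smooth_functions M. v (f * g) = v f * g p + f p * v g)}"

definition vderiv :: "'a vfield \<Rightarrow> ('a \<Rightarrow> real) \<Rightarrow> 'a \<Rightarrow> real" where
  "vderiv X f = (\<lambda>p. X p f)"

definition vector_fields :: "'a manifold \<Rightarrow> 'a vfield set" where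
  "vector_fields M =
     {X. (\<forall>p\<in>points M. X p \<in> tangent_space M p) \<and> (\<forall>p. p \<notin> points M \<longrightarrow> X p = 0) \<and>
         (\<forall>f\<in>smooth_functions M. vderiv X f \<in> smooth_functions M)}"

definition fmult :: "('a \<Rightarrow> real) \<Rightarrow> 'a vfield \<Rightarrow> 'a vfield" where
  "fmult f X = (\<lambda>p g. f p * X p g)"

abbreviation smult_field :: "real \<Rightarrow> 'a vfield \<Rightarrow> 'a vfield" where
  "smult_field c \<equiv> fmult (\<lambda>_. c)"

section \<open>Endomorphisms of the tangent bundle and linear connections\<close>

type_synonym 'a bundle_map = "'a \<Rightarrow> 'a tvec \<Rightarrow> 'a tvec"

definition apply_field :: "'a manifold \<Rightarrow> 'a bundle_map \<Rightarrow> 'a vfield \<Rightarrow> 'a vfield" where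
  "apply_field M E X = (\<lambda>p. if p \<in> points M then E p (X p) else 0)"

definition tangent_endomorphism :: "'a manifold \<Rightarrow> 'a bundle_map \<Rightarrow> bool" where
  "tangent_endomorphism M E \<longleftrightarrow>
     (\<forall>p\<in>points M. \<forall>v\<in>tangent_space M p. E p v \<in> tangent_space M p) \<and>
     (\<forall>p\<in>points M. \<forall>v\<in>tangent_space M p. \<forall>w\<in>tangent_space M p. E p (v + w) = E p v + E p w) \<and>
     (\<forall>p\<in>points M. \<forall>v\<in>tangent_space M p. \<forall>c. E p (\<lambda>f. c * v f) = (\<lambda>f. c * E p v f)) \<and>
     (\<forall>X\<in>vector_fields M. apply_field M E X \<in> vector_fields M)"

definition almost_product_structure :: "'a manifold \<Rightarrow> 'a bundle_map \<Rightarrow> bool" where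
  "almost_product_structure M E \<longleftrightarrow>
     tangent_endomorphism M E \<and> (\<forall>p\<in>points M. \<forall>v\<in>tangent_space M p. E p (E p v) = v)"

type_synonym 'a field_op = "'a vfield \<Rightarrow> 'a vfield \<Rightarrow> 'a vfield"

definition linear_connection :: "'a manifold \<Rightarrow> 'a field_op \<Rightarrow> bool" where
  "linear_connection M D \<longleftrightarrow>
     (\<forall>X\<in>vector_fields M. \<forall>Y\<in>vector_fields M. D X Y \<in> vector_fields M) \<and>
     (\<forall>X\<in>vector_fields M. \<forall>X'\<in>vector_fields M. \<forall>Y\<in>vector_fields M.
        D (X + X') Y = D X Y + D X' Y) \<and>
     (\<forall>f\<in>smooth_functions M. \<forall>X\<in>vector_fields M. \<forall>Y\<in>vector_fields M.
        D (fmult f X) Y = fmult f (D X Y)) \<and>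
     (\<forall>X\<in>vector_fields M. \<forall>Y\<in>vector_fields M. \<forall>Y'\<in>vector_fields M.
        D X (Y + Y') = D X Y + D X Y') \<and>
     (\<forall>c. \<forall>X\<in>vector_fields M. \<forall>Y\<in>vector_fields M.
        D X (smult_field c Y) = smult_field c (D X Y)) \<and>
     (\<forall>f\<in>smooth_functions M. \<forall>X\<in>vector_fields M. \<forall>Y\<in>vector_fields M.
        D X (fmult f Y) = fmult (vderiv X f) Y + fmult f (D X Y))"

definition cov_deriv_endo :: "'a manifold \<Rightarrow> 'a field_op \<Rightarrow> 'a bundle_map \<Rightarrow> 'a field_op" where
  "cov_deriv_endo M D E X Y = D X (apply_field M E Y) - apply_field M E (D X Y)"

definition product_conjugate :: "'a manifold \<Rightarrow> 'a bundle_map \<Rightarrow> 'a field_op \<Rightarrow> 'a field_op" where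
  "product_conjugate M E D X Y = apply_field M E (D X (apply_field M E Y))"

definition structural_tensor :: "'a manifold \<Rightarrow> 'a bundle_map \<Rightarrow> 'a field_op \<Rightarrow> 'a field_op" where
  "structural_tensor M E D X Y =
     smult_field (1/2) (cov_deriv_endo M D E (apply_field M E X) Y
                        + cov_deriv_endo M D E X (apply_field M E Y))"

definition virtual_tensor :: "'a manifold \<Rightarrow> 'a bundle_map \<Rightarrow> 'a field_op \<Rightarrow> 'a field_op" where
  "virtual_tensor M E D X Y =
     smult_field (1/2) (cov_deriv_endo M D E (apply_field M E X) Y
                        - cov_deriv_endo M D E X (apply_field M E Y))"

end

theory Submission
  imports Defs
begin

text \<open>The terms in \<open>\<nabla>\<^bsub>EX\<^esub>E\<close> cancel, so \<open>B - C\<close> is \<open>(X, Y) \<mapsto> - (\<nabla>\<^sub>X E)(EY)\<close>, and expanding this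
  with \<open>E\<^sup>2 = I\<close> gives \<open>E (\<nabla>\<^sub>X (EY)) - \<nabla>\<^sub>X Y\<close>.\<close>

text \<open>On \<open>points M\<close> this is the fibrewise \<open>E p (E p v) = v\<close>;
  elsewhere both sides are 0 by convention. Equality of whole fields is what permits rewriting
  inside \<open>D X\<close>, which takes fields rather than single vectors.\<close>

lemma apply_field_involution:
  assumes "almost_product_structure M E" and "Y \<in> vector_fields M"
  shows "apply_field M E (apply_field M E Y) = Y"
  using assms by (auto simp: apply_field_def almost_product_structure_def vector_fields_def)

lemma virtual_minus_structural:
  "virtual_tensor M E D X Y - structural_tensor M E D X Y
     = - cov_deriv_endo M D E X (apply_field M E Y)"
  by (simp add: virtual_tensor_def structural_tensor_def fmult_def fun_eq_iff field_simps)

theorem mainTheorem4: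
  fixes M :: "'a manifold" and E :: "'a bundle_map" and D :: "'a field_op"
  assumes "smooth_manifold M"
    and "almost_product_structure M E"
    and "linear_connection M D"
  shows "\<forall>X\<in>vector_fields M. \<forall>Y\<in>vector_fields M.
    product_conjugate M E D X Y = D X Y - structural_tensor M E D X Y + virtual_tensor M E D X Y"
proof (intro ballI)
  fix X Y assume "X \<in> vector_fields M" and Y: "Y \<in> vector_fields M"
  \<comment> \<open>In the covariant derivative the term \<open>D X (E (E Y))\<close> becomes
    \<open>D X Y\<close> and cancels, leaving \<open>E (D X (E Y))\<close>.\<close>
  have "product_conjugate M E D X Y = D X Y - cov_deriv_endo M D E X (apply_field M E Y)"
    by (simp add: product_conjugate_def cov_deriv_endo_def apply_field_involution[OF assms(2) Y])
  also have "\<dots> = D X Y + (virtual_tensor M E D X Y - structural_tensor M E D X Y)"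
    by (simp add: virtual_minus_structural)
  finally show "product_conjugate M E D X Y
      = D X Y - structural_tensor M E D X Y + virtual_tensor M E D X Y"
    by (simp add: algebra_simps)
qed

end
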